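(* Let $\mathbf{A}=[a_{ij}]$ be an $n\times n$ pairwise comparison matrix and $\mathbf{w}=(w_1,\dots,w_n)^{\top}$ a positive weight vector. Let $I=\{(i,j)\mid a_{ij}<w_i/w_j\}$ and $J=\{(i,j)\mid a_{ij}=w_i/w_j,\ i<j\}$, and assume $I\ne\emptyset$. Consider the optimization problem in the variables $x_i>0$ ($1\le i\le n$) and $t_{ij}$ ($(i,j)\in I$): \begin{align*} \min \prod_{(i,j)\in I} t_{ij}&\\ \frac{x_j}{x_i}\,a_{ij}&\le 1 &&\text{for all }(i,j)\in I,\\ \frac{x_i}{x_j}\,\frac{w_j}{w_i}\,\frac{1}{t_{ij}}&\le 1 &&\text{for all }(i,j)\in I,\\ 0<t_{ij}&\le 1 &&\text{for all }(i,j)\in I,\\ a_{ji}\,\frac{x_i}{x_j}&=1 &&\text{for all }(i,j)\in J,\\ x_1&=1. \end{align*} The optimum value of this problem is at most $1$, and it is equal to $1$ if and only if $\mathbf{w}$ is efficient with respect to $\mathbf{A}$. Moreover, let $(\mathbf{x}^{\ast},\mathbf{t}^{\ast})\in\mathbb{R}^{n+|I|}_{+}$ be an optimal solution; if $\mathbf{w}$ is inefficient, then the weight vector $\mathbf{x}^{\ast}$ is efficient and dominates $\mathbf{w}$ internally.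
   Context: A pairwise comparison matrix of size $n\times n$ ($n\ge 3$) is a real matrix $\mathbf{A}=[a_{ij}]$ with all entries positive and $a_{ij}=1/a_{ji}$ for all $1\le i,j\le n$. A positive weight vector $\mathbf{w}$ is called efficient (with respect to $\mathbf{A}$) if there is no positive vector $\mathbf{w}'$ such that $|a_{ij}-w'_i/w'_j|\le|a_{ij}-w_i/w_j|$ for all $1\le i,j\le n$ and $|a_{k\ell}-w'_k/w'_\ell|<|a_{k\ell}-w_k/w_\ell|$ for some $1\le k,\ell\le n$. It is called inefficient if it is not efficient. A positive vector $\mathbf{w}'$ dominates $\mathbf{w}$ internally if (i) for all $1\le i,j\le n$: $a_{ij}\le w_i/w_j$ implies $a_{ij}\le w'_i/w'_j\le w_i/w_j$, and $a_{ij}\ge w_i/w_j$ implies $a_{ij}\ge w'_i/w'_j\ge w_i/w_j$; and (ii) for some $1\le k,\ell\le n$ both implications hold: $a_{k\ell}\le w_k/w_\ell$ implies $w'_k/w'_\ell<w_k/w_\ell$, and $a_{k\ell}\ge w_k/w_\ell$ implies $w'_k/w'_\ell>w_k/w_\ell$. *)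

theory Defs
  imports "HOL-Analysis.Analysis"
begin

text \<open>
  The indices \<open>1, \<dots>, n\<close> are the elements of a finite linearly ordered type \<open>'n\<close>, and
  \<open>n = CARD('n)\<close>. The order is needed because the optimization problem below refers to
  pairs with \<open>i < j\<close> and to the first component
  of a vector, whose index is \<open>Min UNIV\<close>.
\<close>

definition pairwise_comparison_matrix :: "real ^ 'n ^ 'n \<Rightarrow> bool" where
  "pairwise_comparison_matrix A \<longleftrightarrow>
     3 \<le> CARD('n) \<and> (\<forall>i j. 0 < A $ i $ j \<and> A $ i $ j = 1 / A $ j $ i)"

definition positive_vec :: "real ^ 'n \<Rightarrow> bool" where
  "positive_vec w \<longleftrightarrow> (\<forall>i. 0 < w $ i)"

text \<open>Efficiency is a notion for positive vectors; positivity of \<open>w\<close> itself is not part of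
  the following predicate and has to be assumed or stated separately.\<close>

definition efficient :: "real ^ 'n ^ 'n \<Rightarrow> real ^ 'n \<Rightarrow> bool" where
  "efficient A w \<longleftrightarrow>
     \<not> (\<exists>w'. positive_vec w' \<and>
          (\<forall>i j. \<bar>A $ i $ j - w' $ i / w' $ j\<bar> \<le> \<bar>A $ i $ j - w $ i / w $ j\<bar>) \<and>
          (\<exists>k l. \<bar>A $ k $ l - w' $ k / w' $ l\<bar> < \<bar>A $ k $ l - w $ k / w $ l\<bar>))"

definition dominates_internally :: "real ^ 'n ^ 'n \<Rightarrow> real ^ 'n \<Rightarrow> real ^ 'n \<Rightarrow> bool" where
  "dominates_internally A w' w \<longleftrightarrow>
     positive_vec w' \<and>
     (\<forall>i j.
        (A $ i $ j \<le> w $ i / w $ j \<longrightarrow>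
           A $ i $ j \<le> w' $ i / w' $ j \<and> w' $ i / w' $ j \<le> w $ i / w $ j) \<and>
        (A $ i $ j \<ge> w $ i / w $ j \<longrightarrow>
           A $ i $ j \<ge> w' $ i / w' $ j \<and> w' $ i / w' $ j \<ge> w $ i / w $ j)) \<and>
     (\<exists>k l.
        (A $ k $ l \<le> w $ k / w $ l \<longrightarrow> w' $ k / w' $ l < w $ k / w $ l) \<and>
        (A $ k $ l \<ge> w $ k / w $ l \<longrightarrow> w' $ k / w' $ l > w $ k / w $ l))"

definition I_pairs :: "real ^ 'n ^ 'n \<Rightarrow> real ^ 'n \<Rightarrow> ('n \<times> 'n) set" where
  "I_pairs A w = {(i, j). A $ i $ j < w $ i / w $ j}"

definition J_pairs ::
    "real ^ 'n::{finite, linorder} ^ 'n::{finite, linorder}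
        \<Rightarrow> real ^ 'n::{finite, linorder}
        \<Rightarrow> ('n \<times> 'n) set" where
  "J_pairs A w = {(i, j). A $ i $ j = w $ i / w $ j \<and> i < j}"

text \<open>The variables \<open>t\<^sub>i\<^sub>j\<close> exist only for \<open>(i, j) \<in> I\<close>; extensionality makes a function on all
  pairs carry exactly this data.\<close>

definition feasible ::
    "real ^ 'n::{finite, linorder} ^ 'n::{finite, linorder}
        \<Rightarrow> real ^ 'n::{finite, linorder}
        \<Rightarrow> real ^ 'n::{finite, linorder}
        \<Rightarrow> ('n \<times> 'n \<Rightarrow> real) \<Rightarrow> bool"
  where
  "feasible A w x t \<longleftrightarrow>
     positive_vec x \<and> t \<in> extensional (I_pairs A w) \<and>
     (\<forall>(i, j) \<in> I_pairs A w. x $ j / x $ i * A $ i $ j \<le> 1) \<and>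
     (\<forall>(i, j) \<in> I_pairs A w. x $ i / x $ j * (w $ j / w $ i) * (1 / t (i, j)) \<le> 1) \<and>
     (\<forall>(i, j) \<in> I_pairs A w. 0 < t (i, j) \<and> t (i, j) \<le> 1) \<and>
     (\<forall>(i, j) \<in> J_pairs A w. A $ j $ i * (x $ i / x $ j) = 1) \<and>
     x $ Min UNIV = 1"

definition objective :: "real ^ 'n ^ 'n \<Rightarrow> real ^ 'n \<Rightarrow> ('n \<times> 'n \<Rightarrow> real) \<Rightarrow> real" where
  "objective A w t = (\<Prod>(i, j) \<in> I_pairs A w. t (i, j))"

definition optimal_solution ::
    "real ^ 'n::{finite, linorder} ^ 'n::{finite, linorder}
        \<Rightarrow> real ^ 'n::{finite, linorder}
        \<Rightarrow> real ^ 'n::{finite, linorder}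
        \<Rightarrow> ('n \<times> 'n \<Rightarrow> real) \<Rightarrow> bool"
  where
  "optimal_solution A w x t \<longleftrightarrow>
     feasible A w x t \<and> (\<forall>x' t'. feasible A w x' t' \<longrightarrow> objective A w t \<le> objective A w t')"

text \<open>A real infimum: it is the minimum only if an optimal solution exists, so attainment has to be
  stated separately.\<close>

definition optimum_value ::
    "real ^ 'n::{finite, linorder} ^ 'n::{finite, linorder}
        \<Rightarrow> real ^ 'n::{finite, linorder}
        \<Rightarrow> real" where
  "optimum_value A w = Inf {objective A w t | x t. feasible A w x t}"

end

theory Submission imports Defs begin

text \<open>
  Internal domination only narrows the range of every ratio, so, up to normalization, the feasible
  \<open>x\<close> are exactly the positive vectors whose ratios lie between those of \<open>A\<close> and those of \<open>w\<close>, and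
  the cheapest \<open>t\<close> is \<open>t\<^sub>i\<^sub>j = (x\<^sub>i / x\<^sub>j) / (w\<^sub>i / w\<^sub>j)\<close>. These \<open>x\<close> form a compact set, so the
  optimum is attained, and a product below \<open>1\<close> amounts to a strict internal improvement of \<open>w\<close>.
  The key point is that a vector dominated by some \<open>w'\<close> is already dominated internally: if
  \<open>r\<^sub>i = w'\<^sub>i / w\<^sub>i\<close>, then \<open>a\<^sub>i\<^sub>j \<le> w\<^sub>i / w\<^sub>j\<close> forces \<open>r\<^sub>i \<le> r\<^sub>j\<close>, so shrinking slightly all
  components of \<open>w\<close> at which \<open>r\<close> is not maximal moves no ratio away from \<open>A\<close>. An internal
  improvement of an optimal \<open>x\<close> would be feasible with a smaller product, so \<open>x\<close> is efficient.
\<close>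

section \<open>Ratio intervals, reciprocity and swapped index pairs\<close>

text \<open>One direction is enough, since reciprocity of \<open>A\<close> turns the opposite
  inequality at \<open>(i, j)\<close> into this one at \<open>(j, i)\<close>. The premise includes
  equality, so ratios that already agree with \<open>A\<close> are frozen, as the constraints over
  \<open>J_pairs\<close> require.\<close>

definition ratios_between :: "real ^ 'n ^ 'n \<Rightarrow> real ^ 'n \<Rightarrow> real ^ 'n \<Rightarrow> bool" where
  "ratios_between A w x \<longleftrightarrow>
     (\<forall>i j. A $ i $ j \<le> w $ i / w $ j \<longrightarrow>
        A $ i $ j \<le> x $ i / x $ j \<and> x $ i / x $ j \<le> w $ i / w $ j)"

text \<open>Restricting to \<open>I_pairs\<close> provides the extensionality that
  \<open>feasible\<close> demands of \<open>t\<close>.\<close>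

definition ratio_quotients ::
    "real ^ 'n ^ 'n \<Rightarrow> real ^ 'n \<Rightarrow> real ^ 'n \<Rightarrow> 'n \<times> 'n \<Rightarrow> real" where
  "ratio_quotients A w x =
     restrict (\<lambda>(i, j). x $ i / x $ j * (w $ j / w $ i)) (I_pairs A w)"

lemma pairwise_comparison_matrix_pos:
  "pairwise_comparison_matrix A \<Longrightarrow> 0 < A $ i $ j"
  unfolding pairwise_comparison_matrix_def by blast

lemma pairwise_comparison_matrix_recip:
  "pairwise_comparison_matrix A \<Longrightarrow> A $ i $ j = 1 / A $ j $ i"
  unfolding pairwise_comparison_matrix_def by blast

lemma positive_vecD: "positive_vec w \<Longrightarrow> 0 < w $ i"
  by (simp add: positive_vec_def)

lemma ratio_le_swap:
  assumes "pairwise_comparison_matrix A" and "positive_vec w"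
  shows "w $ i / w $ j \<le> A $ i $ j \<longleftrightarrow> A $ j $ i \<le> w $ j / w $ i"
proof -
  have "0 < A $ j $ i" "0 < w $ i" "0 < w $ j"
    using assms by (simp_all add: pairwise_comparison_matrix_pos positive_vecD)
  then show ?thesis
    unfolding pairwise_comparison_matrix_recip[OF assms(1), of i j] by (simp add: field_simps)
qed

lemma ratio_less_swap:
  assumes "pairwise_comparison_matrix A" and "positive_vec w"
  shows "w $ i / w $ j < A $ i $ j \<longleftrightarrow> A $ j $ i < w $ j / w $ i"
proof -
  have "0 < A $ j $ i" "0 < w $ i" "0 < w $ j"
    using assms by (simp_all add: pairwise_comparison_matrix_pos positive_vecD)
  then show ?thesis
    unfolding pairwise_comparison_matrix_recip[OF assms(1), of i j] by (simp add: field_simps)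
qed

lemma ratios_swap:
  assumes "positive_vec x" and "positive_vec w"
  shows "x $ i / x $ j \<le> w $ i / w $ j \<longleftrightarrow> w $ j / w $ i \<le> x $ j / x $ i"
  using positive_vecD[OF assms(1), of i] positive_vecD[OF assms(1), of j]
    positive_vecD[OF assms(2), of i] positive_vecD[OF assms(2), of j]
  by (simp add: field_simps)

text \<open>Recovers the mirror half left out of \<open>ratios_between\<close>.\<close>

lemma ratios_between_swap:
  assumes A: "pairwise_comparison_matrix A" and w: "positive_vec w" and x: "positive_vec x"
    and b: "ratios_between A w x" and "w $ i / w $ j \<le> A $ i $ j"
  shows "x $ i / x $ j \<le> A $ i $ j" and "w $ i / w $ j \<le> x $ i / x $ j"
proof -
  have "A $ j $ i \<le> w $ j / w $ i"
    using assms(5) ratio_le_swap[OF A w] by blast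
  then have "A $ j $ i \<le> x $ j / x $ i" "x $ j / x $ i \<le> w $ j / w $ i"
    using b unfolding ratios_between_def by blast+
  then show "x $ i / x $ j \<le> A $ i $ j" "w $ i / w $ j \<le> x $ i / x $ j"
    using ratio_le_swap[OF A x] ratios_swap[OF x w] by blast+
qed

lemma ratios_between_refl: "ratios_between A w w"
  by (simp add: ratios_between_def)

lemma ratios_between_trans:
  "ratios_between A w x \<Longrightarrow> ratios_between A x y \<Longrightarrow> ratios_between A w y"
  unfolding ratios_between_def by (meson order_trans)

section \<open>Efficiency and internal domination\<close>

text \<open>At a pair where \<open>A\<close> and \<open>w\<close> agree, the two strict implications
  contradict each other, so the witness lies strictly on one side; if it lies on the wrong one,
  swapping the indices moves it into \<open>I_pairs\<close>.\<close>

lemma dominates_internally_iff: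
  assumes A: "pairwise_comparison_matrix A" and w: "positive_vec w"
  shows "dominates_internally A x w \<longleftrightarrow>
    positive_vec x \<and> ratios_between A w x \<and>
    (\<exists>(k, l) \<in> I_pairs A w. x $ k / x $ l < w $ k / w $ l)" (is "?L \<longleftrightarrow> ?R")
proof
  assume L: ?L
  then have x: "positive_vec x" and b: "ratios_between A w x"
    unfolding dominates_internally_def ratios_between_def by blast+
  from L obtain k l where
    kl: "A $ k $ l \<le> w $ k / w $ l \<longrightarrow> x $ k / x $ l < w $ k / w $ l"
      "A $ k $ l \<ge> w $ k / w $ l \<longrightarrow> x $ k / x $ l > w $ k / w $ l"
    unfolding dominates_internally_def by blast
  consider "A $ k $ l < w $ k / w $ l" | "w $ k / w $ l < A $ k $ l"
    using kl by linarith
  then have "\<exists>(k, l) \<in> I_pairs A w. x $ k / x $ l < w $ k / w $ l"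
  proof cases
    case 1
    then show ?thesis using kl unfolding I_pairs_def by auto
  next
    case 2
    then have "(l, k) \<in> I_pairs A w"
      using ratio_less_swap[OF A w] unfolding I_pairs_def by auto
    moreover have "x $ l / x $ k < w $ l / w $ k"
      using kl(2) 2 ratios_swap[OF w x, of l k] by (simp add: not_le[symmetric])
    ultimately show ?thesis by blast
  qed
  with x b show ?R by blast
next
  assume R: ?R
  then obtain k l where "A $ k $ l < w $ k / w $ l" "x $ k / x $ l < w $ k / w $ l"
    unfolding I_pairs_def by auto
  then show ?L
    using R ratios_between_swap[OF A w] unfolding dominates_internally_def ratios_between_def
    by (meson leD)
qed

text \<open>A ratio that moves towards an entry of \<open>A\<close> without passing it does not
  increase the distance.\<close>

lemma dominates_internally_imp_not_efficient:
  assumes "dominates_internally A x w"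
  shows "\<not> efficient A w"
proof -
  have x: "positive_vec x"
    and le: "\<And>i j. \<bar>A $ i $ j - x $ i / x $ j\<bar> \<le> \<bar>A $ i $ j - w $ i / w $ j\<bar>"
    using assms unfolding dominates_internally_def by (blast, smt (verit))
  have "\<exists>k l. \<bar>A $ k $ l - x $ k / x $ l\<bar> < \<bar>A $ k $ l - w $ k / w $ l\<bar>"
    using assms unfolding dominates_internally_def by (smt (verit))
  with x le show ?thesis
    unfolding efficient_def by blast
qed

lemma not_efficient_imp_dominates_internally:
  fixes A :: "real ^ 'n ^ 'n"
  assumes A: "pairwise_comparison_matrix A" and w: "positive_vec w"
    and "\<not> efficient A w"
  obtains x where "dominates_internally A x w"
proof -
  obtain v k l where v: "positive_vec v"
    and le: "\<And>i j. \<bar>A $ i $ j - v $ i / v $ j\<bar> \<le> \<bar>A $ i $ j - w $ i / w $ j\<bar>"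
    and kl: "\<bar>A $ k $ l - v $ k / v $ l\<bar> < \<bar>A $ k $ l - w $ k / w $ l\<bar>"
    using assms(3) unfolding efficient_def by blast
  define r where "r i = v $ i / w $ i" for i
  note pos = positive_vecD[OF w] positive_vecD[OF v] pairwise_comparison_matrix_pos[OF A]
  have r_le_iff: "r i \<le> r j \<longleftrightarrow> v $ i / v $ j \<le> w $ i / w $ j" for i j
    unfolding r_def using pos(1)[of i] pos(1)[of j] pos(2)[of i] pos(2)[of j]
    by (simp add: field_simps)
  \<comment> \<open>A larger ratio of \<open>v\<close> would lie farther from \<open>A\<close> than
    that of \<open>w\<close>. The ratio of \<open>v\<close> may still pass below \<open>A\<close>,
    so only the order of the values of \<open>r\<close> is used, not \<open>v\<close>
    itself.\<close>
  have r_mono: "r i \<le> r j" if "A $ i $ j \<le> w $ i / w $ j" for i j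
    using le[of i j] that unfolding r_le_iff by linarith
  have r_strict: "A $ i $ j < w $ i / w $ j" if "r i < r j" for i j
  proof -
    have "\<not> A $ j $ i \<le> w $ j / w $ i"
      using r_mono that by (meson leD)
    then show ?thesis
      using ratio_le_swap[OF A w, of i j] by linarith
  qed
  \<comment> \<open>Equal values would give \<open>v\<close> and \<open>w\<close> the same ratio at
    \<open>(k, l)\<close>, against the strict improvement there.\<close>
  have "r k \<noteq> r l"
    using kl r_le_iff[of k l] ratios_swap[OF v w, of l k] r_le_iff[of l k] by auto
  define m where "m = Max (range r)"
  have r_le_m: "r i \<le> m" for i
    unfolding m_def by simp
  obtain top where top: "r top = m"
    unfolding m_def by (metis Max_in finite finite_imageI UNIV_not_empty image_is_empty imageE)
  obtain low where low: "r low < m"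
    using \<open>r k \<noteq> r l\<close> r_le_m[of k] r_le_m[of l] by (metis order_le_less)
  \<comment> \<open>This pair makes the set \<open>Q\<close> below nonempty, and it is the one whose
    ratio drops strictly.\<close>
  have top_low: "(low, top) \<in> I_pairs A w"
    using r_strict low top unfolding I_pairs_def by auto
  define Q where "Q = (\<lambda>(i, j). A $ i $ j * w $ j / w $ i) ` I_pairs A w"
  have finQ: "finite Q" and neQ: "Q \<noteq> {}"
    unfolding Q_def using top_low by auto
  \<comment> \<open>The strongest shrinking that carries no ratio past the corresponding entry of \<open>A\<close>.\<close>
  define q where "q = Max Q"
  have "q \<in> Q"
    unfolding q_def using finQ neQ by (rule Max_in)
  then have q: "0 < q" "q < 1"
    unfolding Q_def I_pairs_def using pos by (auto simp: field_simps)
  have q_le: "A $ i $ j \<le> q * (w $ i / w $ j)" if "A $ i $ j < w $ i / w $ j" for i j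
  proof -
    have "A $ i $ j * w $ j / w $ i \<in> Q"
      unfolding Q_def I_pairs_def using that by force
    then have "A $ i $ j * w $ j / w $ i \<le> q"
      unfolding q_def using finQ by simp
    then show ?thesis
      using pos(1)[of i] pos(1)[of j] by (simp add: field_simps)
  qed
  define x where "x = (\<chi> i. (if r i = m then 1 else q) * w $ i)"
  have x: "positive_vec x"
    unfolding positive_vec_def x_def using q pos(1) by simp
  have "ratios_between A w x"
    unfolding ratios_between_def
  proof (intro allI impI)
    fix i j
    assume a: "A $ i $ j \<le> w $ i / w $ j"
    \<comment> \<open>The only case in which the ratio would grow, \<open>r i = m\<close> with
      \<open>r j < m\<close>, is excluded by \<open>r_mono\<close>.\<close>
    consider "r i = m \<longleftrightarrow> r j = m" | "r i \<noteq> m" "r j = m"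
      using r_mono[OF a] r_le_m[of j] by fastforce
    then show "A $ i $ j \<le> x $ i / x $ j \<and> x $ i / x $ j \<le> w $ i / w $ j"
    proof cases
      case 1
      then have "x $ i / x $ j = w $ i / w $ j"
        unfolding x_def using q by simp
      then show ?thesis using a by simp
    next
      case 2
      then have "r i < r j"
        using r_le_m[of i] by simp
      then have "A $ i $ j \<le> q * (w $ i / w $ j)"
        using r_strict q_le by blast
      moreover have "q * (w $ i / w $ j) \<le> 1 * (w $ i / w $ j)"
        using q pos(1)[of i] pos(1)[of j] by (intro mult_right_mono) simp_all
      ultimately show ?thesis
        using 2 unfolding x_def by simp
    qed
  qed
  moreover have "x $ low / x $ top < w $ low / w $ top"
    using low top q pos(1)[of low] pos(1)[of top] unfolding x_def by (simp add: field_simps)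
  ultimately have "dominates_internally A x w"
    unfolding dominates_internally_iff[OF A w] using x top_low by blast
  then show thesis by (rule that)
qed

section \<open>Feasible points in terms of ratios\<close>

text \<open>Domination sees only ratios, while feasibility fixes one component; rescaling connects
  the two.\<close>

lemma normalize_ratios:
  fixes x :: "real ^ 'n"
  assumes "positive_vec x"
  obtains y where "positive_vec y" and "y $ k = 1"
    and "\<And>i j. y $ i / y $ j = x $ i / x $ j"
proof
  have "0 < x $ i" for i
    using assms by (rule positive_vecD)
  then show "positive_vec (\<chi> i. x $ i / x $ k)" "(\<chi> i. x $ i / x $ k) $ k = 1"
    "\<And>i j. (\<chi> i. x $ i / x $ k) $ i / (\<chi> i. x $ i / x $ k) $ j = x $ i / x $ j"
    by (simp_all add: positive_vec_def field_simps less_imp_neq[symmetric])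
qed

text \<open>The constraints on \<open>t\<close> sandwich it between the quotient and
  \<open>1\<close>, which yields the upper bound on each ratio in \<open>I_pairs\<close>;
  conversely, \<open>t\<close> is positive because the quotients are.\<close>

lemma feasible_iff:
  fixes A :: "real ^ 'n::{finite, linorder} ^ 'n::{finite, linorder}"
  assumes A: "pairwise_comparison_matrix A" and w: "positive_vec w"
  shows "feasible A w x t \<longleftrightarrow>
    positive_vec x \<and> x $ Min UNIV = 1 \<and> ratios_between A w x \<and>
    t \<in> extensional (I_pairs A w) \<and>
    (\<forall>p \<in> I_pairs A w. ratio_quotients A w x p \<le> t p \<and> t p \<le> 1)" (is "?L \<longleftrightarrow> ?R")
proof
  assume L: ?L
  then have x: "positive_vec x"
    unfolding feasible_def by blast
  note pos = positive_vecD[OF w] positive_vecD[OF x] pairwise_comparison_matrix_pos[OF A]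
  have t: "ratio_quotients A w x (i, j) \<le> t (i, j)" "0 < t (i, j)" "t (i, j) \<le> 1"
    and lower: "A $ i $ j \<le> x $ i / x $ j" if "(i, j) \<in> I_pairs A w" for i j
    using L that pos unfolding feasible_def ratio_quotients_def by (auto simp: field_simps)
  have upper: "x $ i / x $ j \<le> w $ i / w $ j" if "(i, j) \<in> I_pairs A w" for i j
  proof -
    have "x $ i / x $ j * (w $ j / w $ i) \<le> 1"
      using t[OF that] that unfolding ratio_quotients_def by simp
    then show ?thesis
      using pos(1)[of i] pos(1)[of j] pos(2)[of j] by (simp add: field_simps)
  qed
  have tight: "x $ i / x $ j = A $ i $ j" if "(i, j) \<in> J_pairs A w" for i j
  proof -
    have "A $ j $ i * (x $ i / x $ j) = 1"
      using L that unfolding feasible_def by auto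
    then show ?thesis
      using pos(2)[of i] pos(3)[of j i] unfolding pairwise_comparison_matrix_recip[OF A, of i j]
      by (simp add: eq_divide_eq mult.commute)
  qed
  have "A $ i $ j \<le> x $ i / x $ j \<and> x $ i / x $ j \<le> w $ i / w $ j"
    if "A $ i $ j \<le> w $ i / w $ j" for i j
  proof (cases "A $ i $ j = w $ i / w $ j")
    case False
    then show ?thesis using that lower upper unfolding I_pairs_def by simp
  next
    case True
    have "x $ i / x $ j = A $ i $ j"
    \<comment> \<open>\<open>J_pairs\<close> lists each tie only with \<open>i < j\<close>; the
      diagonal is trivial and the reversed pair follows by taking reciprocals.\<close>
    proof (cases i j rule: linorder_cases)
      case less
      then show ?thesis using True tight unfolding J_pairs_def by simp
    next
      case equal
      then show ?thesis using True pos(1)[of j] pos(2)[of j] by simp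
    next
      case greater
      have recip: "A $ j $ i = 1 / A $ i $ j"
        by (rule pairwise_comparison_matrix_recip[OF A])
      with True greater have "(j, i) \<in> J_pairs A w"
        unfolding J_pairs_def by simp
      then have "x $ j / x $ i = 1 / A $ i $ j"
        using tight recip by simp
      then show ?thesis
        using pos(2)[of i] pos(2)[of j] pos(3)[of i j] by (simp add: field_simps)
    qed
    then show ?thesis using True by simp
  qed
  then have "ratios_between A w x"
    unfolding ratios_between_def by blast
  then show ?R
    using L t unfolding feasible_def by auto
next
  assume R: ?R
  then have x: "positive_vec x" and b: "ratios_between A w x"
    by blast+
  note pos = positive_vecD[OF w] positive_vecD[OF x] pairwise_comparison_matrix_pos[OF A]
  have I: "x $ j / x $ i * A $ i $ j \<le> 1"
    "x $ i / x $ j * (w $ j / w $ i) * (1 / t (i, j)) \<le> 1" "0 < t (i, j)" "t (i, j) \<le> 1"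
    if ij: "(i, j) \<in> I_pairs A w" for i j
  proof -
    have "A $ i $ j \<le> x $ i / x $ j"
      using b ij unfolding ratios_between_def I_pairs_def by auto
    then show "x $ j / x $ i * A $ i $ j \<le> 1"
      using pos(2)[of i] pos(2)[of j] by (simp add: field_simps)
    have q: "x $ i / x $ j * (w $ j / w $ i) \<le> t (i, j)" and "t (i, j) \<le> 1"
      using R ij unfolding ratio_quotients_def by fastforce+
    then show "t (i, j) \<le> 1" by simp
    have "0 < x $ i / x $ j * (w $ j / w $ i)"
      using pos by simp
    with q show "0 < t (i, j)" by linarith
    with q show "x $ i / x $ j * (w $ j / w $ i) * (1 / t (i, j)) \<le> 1"
      by (metis divide_le_eq_1_pos mult.right_neutral times_divide_eq_right)
  qed
  have "A $ j $ i * (x $ i / x $ j) = 1" if "(i, j) \<in> J_pairs A w" for i j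
  proof -
    have "A $ i $ j = w $ i / w $ j"
      using that unfolding J_pairs_def by simp
    then have "x $ i / x $ j = A $ i $ j"
      using b[unfolded ratios_between_def, rule_format, of i j] by linarith
    then show ?thesis
      using pos(3)[of j i] pairwise_comparison_matrix_recip[OF A, of i j] by simp
  qed
  with R I show ?L
    unfolding feasible_def by blast
qed

lemma ratio_quotients_pos:
  "positive_vec w \<Longrightarrow> positive_vec x \<Longrightarrow> p \<in> I_pairs A w \<Longrightarrow> 0 < ratio_quotients A w x p"
  unfolding ratio_quotients_def by (cases p) (simp add: positive_vecD)

lemma ratio_quotients_le_iff:
  assumes "positive_vec w" and "(i, j) \<in> I_pairs A w"
  shows "ratio_quotients A w y (i, j) \<le> ratio_quotients A w x (i, j) \<longleftrightarrow>
    y $ i / y $ j \<le> x $ i / x $ j"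
proof -
  have "0 < w $ j / w $ i"
    using assms(1) by (simp add: positive_vecD)
  then show ?thesis
    using assms(2) unfolding ratio_quotients_def
    by (simp only: restrict_apply if_True case_prod_conv mult_le_cancel_right_pos)
qed

text \<open>The value \<open>1\<close> is the quotient of \<open>w\<close> itself.\<close>

lemma ratio_quotients_le_one_iff:
  assumes "positive_vec w" and "(i, j) \<in> I_pairs A w"
  shows "ratio_quotients A w x (i, j) \<le> 1 \<longleftrightarrow> x $ i / x $ j \<le> w $ i / w $ j"
proof -
  have "ratio_quotients A w w (i, j) = 1"
    using assms positive_vecD[OF assms(1), of i] positive_vecD[OF assms(1), of j]
    unfolding ratio_quotients_def by simp
  then show ?thesis
    using ratio_quotients_le_iff[OF assms, of x w] by simp
qed

lemma feasible_ratio_quotients: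
  fixes A :: "real ^ 'n::{finite, linorder} ^ 'n::{finite, linorder}"
  assumes A: "pairwise_comparison_matrix A" and w: "positive_vec w"
    and "positive_vec x" and "x $ Min UNIV = 1" and b: "ratios_between A w x"
  shows "feasible A w x (ratio_quotients A w x)"
proof -
  have "ratio_quotients A w x (i, j) \<le> 1" if "(i, j) \<in> I_pairs A w" for i j
    using b that unfolding ratio_quotients_le_one_iff[OF w that] ratios_between_def I_pairs_def
    by auto
  moreover have "ratio_quotients A w x \<in> extensional (I_pairs A w)"
    unfolding ratio_quotients_def by simp
  ultimately show ?thesis
    unfolding feasible_iff[OF A w] using assms by auto
qed

section \<open>Monotonicity of the objective and attainment of the optimum\<close>

lemma objective_mono:
  assumes "\<And>p. p \<in> I_pairs A w \<Longrightarrow> 0 < s p" and "\<And>p. p \<in> I_pairs A w \<Longrightarrow> s p \<le> t p"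
  shows "objective A w s \<le> objective A w t"
  unfolding objective_def using assms by (auto intro!: prod_mono simp: less_imp_le)

lemma objective_strict_mono:
  assumes "\<And>p. p \<in> I_pairs A w \<Longrightarrow> 0 < s p" and "\<And>p. p \<in> I_pairs A w \<Longrightarrow> s p \<le> t p"
    and "p \<in> I_pairs A w" and "s p < t p"
  shows "objective A w s < objective A w t"
proof -
  have "prod s (I_pairs A w) < prod t (I_pairs A w)"
    using assms by (intro prod_mono_strict[of p] conjI)
      (blast intro: finite less_imp_le less_le_trans)+
  then show ?thesis
    unfolding objective_def by simp
qed

text \<open>Every feasible \<open>t\<close> lies above the quotients of its \<open>x\<close>, so it
  suffices to minimize the product of quotients over \<open>x\<close> alone, a continuous function
  on a nonempty compact set.\<close>

lemma optimal_solution_exists: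
  fixes A :: "real ^ 'n::{finite, linorder} ^ 'n::{finite, linorder}"
  assumes A: "pairwise_comparison_matrix A" and w: "positive_vec w"
  shows "\<exists>x t. optimal_solution A w x t"
proof -
  let ?o = "Min UNIV :: 'n"
  define S where "S = {x. positive_vec x \<and> x $ ?o = 1 \<and> ratios_between A w x}"
  \<comment> \<open>Since the first component is \<open>1\<close>, each \<open>x $ i\<close> equals
    its ratio to that component, which lies between the corresponding ratios of \<open>A\<close> and
    \<open>w\<close>, in whichever order these stand.\<close>
  define lo hi :: "real ^ 'n::{finite, linorder}"
    where "lo = (\<chi> i. min (A $ i $ ?o) (w $ i / w $ ?o))"
      and "hi = (\<chi> i. max (A $ i $ ?o) (w $ i / w $ ?o))"
  note pos = positive_vecD[OF w] pairwise_comparison_matrix_pos[OF A]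
  have lo: "0 < lo $ i" for i
    unfolding lo_def using pos by simp
  have box: "lo $ i \<le> x $ i \<and> x $ i \<le> hi $ i" if "x \<in> S" for x i
  proof -
    from that have x: "positive_vec x" "x $ ?o = 1" and b: "ratios_between A w x"
      unfolding S_def by auto
    show ?thesis
    proof (cases "A $ i $ ?o \<le> w $ i / w $ ?o")
      case True
      then have "A $ i $ ?o \<le> x $ i / x $ ?o" "x $ i / x $ ?o \<le> w $ i / w $ ?o"
        using b unfolding ratios_between_def by blast+
      then show ?thesis unfolding lo_def hi_def by (simp add: x(2))
    next
      case False
      then show ?thesis
        using ratios_between_swap[OF A w x(1) b, of i ?o] unfolding lo_def hi_def
        by (simp add: x(2))
    qed
  qed
  \<comment> \<open>Strict positivity is not a closed condition; the lower bound \<open>lo\<close> replaces it.\<close>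
  have S_eq: "S = cbox lo hi \<inter> {x. x $ ?o = 1 \<and>
      (\<forall>i j. A $ i $ j \<le> w $ i / w $ j \<longrightarrow>
        A $ i $ j * x $ j \<le> x $ i \<and> x $ i \<le> w $ i / w $ j * x $ j)}" (is "_ = ?T")
  proof (intro set_eqI iffI)
    fix x assume x: "x \<in> S"
    then have "0 < x $ j" for j
      unfolding S_def by (simp add: positive_vecD)
    with x show "x \<in> ?T"
      using box[OF x] unfolding S_def ratios_between_def
      by (simp add: mem_box_cart pos_le_divide_eq pos_divide_le_eq)
  next
    fix x assume x: "x \<in> ?T"
    have "0 < x $ j" for j
      using lo[of j] x unfolding Int_iff mem_box_cart by (meson less_le_trans)
    with x show "x \<in> S"
      unfolding S_def ratios_between_def positive_vec_def
      by (simp add: pos_le_divide_eq pos_divide_le_eq)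
  qed
  \<comment> \<open>With denominators cleared, each condition compares functions continuous on the
    whole space, and the premise of the implication does not depend on \<open>x\<close>.\<close>
  have "closed {x :: real ^ 'n::{finite, linorder}. x $ ?o = 1 \<and>
      (\<forall>i j. A $ i $ j \<le> w $ i / w $ j \<longrightarrow>
        A $ i $ j * x $ j \<le> x $ i \<and> x $ i \<le> w $ i / w $ j * x $ j)}"
    by (intro closed_Collect_conj closed_Collect_all closed_Collect_imp closed_Collect_le
        closed_Collect_eq open_Collect_const continuous_intros)
  then have "compact S"
    unfolding S_eq by (intro compact_Int_closed compact_cbox)
  obtain y where y: "positive_vec y" "y $ ?o = 1" "\<And>i j. y $ i / y $ j = w $ i / w $ j"
    using normalize_ratios[OF w] by blast
  then have "S \<noteq> {}"
    unfolding S_def ratios_between_def by auto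
  have "continuous_on S (\<lambda>x. \<Prod>p \<in> I_pairs A w.
      x $ fst p / x $ snd p * (w $ snd p / w $ fst p))"
    unfolding S_def
    by (intro continuous_intros) (auto simp: positive_vec_def less_imp_neq[symmetric])
  moreover have "objective A w (ratio_quotients A w x) =
      (\<Prod>p \<in> I_pairs A w. x $ fst p / x $ snd p * (w $ snd p / w $ fst p))" for x
    unfolding objective_def ratio_quotients_def by (intro prod.cong) auto
  ultimately have "continuous_on S (\<lambda>x. objective A w (ratio_quotients A w x))"
    by simp
  then obtain x where x: "x \<in> S"
    and min: "\<And>z. z \<in> S \<Longrightarrow>
      objective A w (ratio_quotients A w x) \<le> objective A w (ratio_quotients A w z)"
    using continuous_attains_inf[OF \<open>compact S\<close> \<open>S \<noteq> {}\<close>] by blast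
  have "feasible A w x (ratio_quotients A w x)"
    using x feasible_ratio_quotients[OF A w] unfolding S_def by blast
  moreover have "objective A w (ratio_quotients A w x) \<le> objective A w t"
    if "feasible A w z t" for z t
  proof -
    from that have z: "z \<in> S" "positive_vec z"
      and t: "\<And>p. p \<in> I_pairs A w \<Longrightarrow> ratio_quotients A w z p \<le> t p"
      unfolding feasible_iff[OF A w] S_def by auto
    note min[OF z(1)]
    also have "objective A w (ratio_quotients A w z) \<le> objective A w t"
      using t ratio_quotients_pos[OF w z(2)] by (intro objective_mono)
    finally show ?thesis .
  qed
  ultimately show ?thesis
    unfolding optimal_solution_def by blast
qed

section \<open>The optimum value and its link to efficiency\<close>

lemma optimum_value_eq:
  assumes "optimal_solution A w x t"
  shows "optimum_value A w = objective A w t"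
  unfolding optimum_value_def using assms unfolding optimal_solution_def
  by (intro cInf_eq_minimum) blast+

lemma objective_one: "objective A w (\<lambda>p. 1) = 1"
  by (simp add: objective_def case_prod_beta)

text \<open>Stated for any \<open>t\<close> above the quotients of \<open>x\<close>, so that it
  serves twice: for \<open>w\<close> with the constant \<open>1\<close>, showing that the optimum of
  an inefficient \<open>w\<close> is below \<open>1\<close>, and for an optimal solution, showing
  that its \<open>x\<close> is efficient.\<close>

lemma dominates_internally_improves_feasible:
  fixes A :: "real ^ 'n::{finite, linorder} ^ 'n::{finite, linorder}"
  assumes A: "pairwise_comparison_matrix A" and w: "positive_vec w"
    and x: "positive_vec x" and b: "ratios_between A w x"
    and t: "\<And>p. p \<in> I_pairs A w \<Longrightarrow> ratio_quotients A w x p \<le> t p"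
    and dom: "dominates_internally A z x"
  obtains y s where "feasible A w y s" and "objective A w s < objective A w t"
proof -
  from dom obtain k l where z: "positive_vec z" and bz: "ratios_between A x z"
    and kl: "A $ k $ l < x $ k / x $ l" "z $ k / z $ l < x $ k / x $ l"
    unfolding dominates_internally_iff[OF A x] I_pairs_def by auto
  obtain y where y: "positive_vec y" "y $ Min UNIV = 1" "\<And>i j. y $ i / y $ j = z $ i / z $ j"
    using normalize_ratios[OF z] by blast
  have "ratios_between A w y"
    using ratios_between_trans[OF b bz] unfolding ratios_between_def y(3) .
  then have feas: "feasible A w y (ratio_quotients A w y)"
    using feasible_ratio_quotients[OF A w y(1,2)] by blast
  have "ratio_quotients A w y p \<le> ratio_quotients A w x p" if "p \<in> I_pairs A w" for p
  proof (cases p)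
    case (Pair i j)
    with that have ij: "(i, j) \<in> I_pairs A w" by simp
    then have "A $ i $ j \<le> x $ i / x $ j"
      using b unfolding ratios_between_def I_pairs_def by auto
    then show ?thesis
      using bz unfolding Pair ratio_quotients_le_iff[OF w ij] y(3) ratios_between_def by blast
  qed
  then have le: "ratio_quotients A w y p \<le> t p" if "p \<in> I_pairs A w" for p
    using t that by (meson order_trans)
  \<comment> \<open>If the ratio of \<open>w\<close> were at most the entry of \<open>A\<close>,
    that of \<open>x\<close> would be too, contrary to the choice of \<open>(k, l)\<close>.\<close>
  have I: "(k, l) \<in> I_pairs A w"
    using ratios_between_swap(1)[OF A w x b, of k l] kl(1) unfolding I_pairs_def by force
  have "ratio_quotients A w y (k, l) < ratio_quotients A w x (k, l)"
    using kl(2) unfolding not_le[symmetric] ratio_quotients_le_iff[OF w I] y(3) .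
  then have "ratio_quotients A w y (k, l) < t (k, l)"
    using t[OF I] by linarith
  then have "objective A w (ratio_quotients A w y) < objective A w t"
    using ratio_quotients_pos[OF w y(1)] le I
    by (intro objective_strict_mono[of A w _ t "(k, l)"]) blast+
  with feas show thesis by (rule that)
qed

theorem proposition4p1:
  fixes A :: "real ^ 'n::{finite, linorder} ^ 'n::{finite, linorder}"
    and w :: "real ^ 'n::{finite, linorder}"
  assumes "pairwise_comparison_matrix A"
    and "positive_vec w"
    and "I_pairs A w \<noteq> {}"
  shows "(\<exists>x t. optimal_solution A w x t) \<and>
         optimum_value A w \<le> 1 \<and>
         (optimum_value A w = 1 \<longleftrightarrow> efficient A w) \<and>
         (\<forall>x t. optimal_solution A w x t \<longrightarrow> \<not> efficient A w \<longrightarrow>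
            efficient A x \<and> dominates_internally A x w)"
proof -
  note A = assms(1) and w = assms(2)
  have *: "objective A w t \<le> 1 \<and> (\<not> efficient A w \<longrightarrow> objective A w t < 1) \<and>
      (objective A w t < 1 \<longrightarrow> dominates_internally A x w) \<and> efficient A x"
    if opt: "optimal_solution A w x t" for x t
  proof (intro conjI impI)
    have min: "objective A w t \<le> objective A w s" if "feasible A w y s" for y s
      using opt that unfolding optimal_solution_def by blast
    have x: "positive_vec x" and b: "ratios_between A w x"
      and t: "\<And>p. p \<in> I_pairs A w \<Longrightarrow> ratio_quotients A w x p \<le> t p"
      and t1: "\<And>p. p \<in> I_pairs A w \<Longrightarrow> t p \<le> 1"
      using opt unfolding optimal_solution_def feasible_iff[OF A w] by auto
    have tpos: "0 < t p" if "p \<in> I_pairs A w" for p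
      using ratio_quotients_pos[OF w x that] t[OF that] by linarith
    show "objective A w t \<le> 1"
      using objective_mono[of A w t "\<lambda>p. 1", OF tpos t1] by (simp add: objective_one)
    show "objective A w t < 1" if ineff: "\<not> efficient A w"
    proof -
      obtain z where z: "dominates_internally A z w"
        using not_efficient_imp_dominates_internally[OF A w ineff] .
      have "ratio_quotients A w w p \<le> 1" if "p \<in> I_pairs A w" for p
        using that ratio_quotients_le_one_iff[OF w, of _ _ A w] by (cases p) simp
      then obtain y s where "feasible A w y s" "objective A w s < objective A w (\<lambda>p. 1)"
        by (rule dominates_internally_improves_feasible[OF A w w ratios_between_refl _ z])
      with min show ?thesis
        unfolding objective_one by (meson le_less_trans)
    qed
    show "dominates_internally A x w" if less: "objective A w t < 1"
    proof -
      \<comment> \<open>Otherwise \<open>t\<close>, which lies above the quotients, would be at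
        least \<open>1\<close> everywhere, and so would the product.\<close>
      have "\<exists>p \<in> I_pairs A w. ratio_quotients A w x p < 1"
      proof (rule ccontr)
        assume "\<not> ?thesis"
        then have "1 \<le> t p" if "p \<in> I_pairs A w" for p
          using t[OF that] that by force
        then have "objective A w (\<lambda>p. 1) \<le> objective A w t"
          by (intro objective_mono) simp_all
        with less show False by (simp add: objective_one)
      qed
      then obtain k l where kl: "(k, l) \<in> I_pairs A w" "ratio_quotients A w x (k, l) < 1"
        by auto
      then have "x $ k / x $ l < w $ k / w $ l"
        using ratio_quotients_le_one_iff[OF w kl(1), of x]
        using positive_vecD[OF w, of k] positive_vecD[OF w, of l] positive_vecD[OF x, of l]
        by (auto simp: ratio_quotients_def field_simps)
      with kl x b show ?thesis
        unfolding dominates_internally_iff[OF A w] by blast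
    qed
    show "efficient A x"
    proof (rule ccontr)
      assume "\<not> efficient A x"
      then obtain z where z: "dominates_internally A z x"
        using not_efficient_imp_dominates_internally[OF A x] by blast
      from t obtain y s where "feasible A w y s" "objective A w s < objective A w t"
        by (rule dominates_internally_improves_feasible[OF A w x b _ z])
      with min show False by (meson leD)
    qed
  qed
  obtain x t where opt: "optimal_solution A w x t"
    using optimal_solution_exists[OF A w] by blast
  \<comment> \<open>A value below \<open>1\<close> gives internal domination of \<open>w\<close>,
    hence inefficiency; the converse is the second clause of \<open>*\<close>.\<close>
  have "optimum_value A w = 1 \<longleftrightarrow> efficient A w"
    using *[OF opt] dominates_internally_imp_not_efficient
    unfolding optimum_value_eq[OF opt] by force
  moreover have "optimum_value A w \<le> 1"
    unfolding optimum_value_eq[OF opt] using *[OF opt] by blast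
  ultimately show ?thesis
    using * opt by blast
qed

end
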